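(* Let $\zeta\in\mathcal P_+(\mathcal Z)$ be arbitrary. The generalised Dirichlet form $\mathscr E_\zeta$ and the generalised Fisher information $\mathscr R_\zeta$ (with respect to the fixed irreducible generator $M$) satisfy the following. 1. (Continuity) The maps $(\zeta,f)\mapsto\mathscr E_\zeta(f)$ and $(\zeta,\varphi)\mapsto\mathscr R_\zeta(\varphi)$ are continuous on $\mathcal P_+(\mathcal Z)\times\mathbb R^{|\mathcal Z|}$ and on $\{(\zeta,\varphi):\zeta\in\mathcal P_+(\mathcal Z),\ \varphi\in\mathcal D_\zeta(\mathcal Z)\}$, respectively. 2. (Non-negativity) $\mathscr E_\zeta(f)\ge 0$ for all $f\in\mathbb R^{|\mathcal Z|}$, with equality if and only if $f\in\langle\mathbf 1\rangle$; and $\mathscr R_\zeta(\varphi)\ge 0$ for all $\varphi\in\mathcal D_\zeta(\mathcal Z)$, with equality if and only if $\varphi=\mathbf 1$. 3. (Convexity) $\mathscr E_\zeta(\cdot)$ is convex on $\mathbb R^{|\mathcal Z|}$ and $\mathscr R_\zeta(\cdot)$ is convex on $\mathcal D_\zeta(\mathcal Z)$. 4. (Connection) Let $f\in\mathbb R^{|\mathcal Z|}$ with $\mathbb E_\zeta[f]=0$. Then for all $\delta\in\mathbb R$ with $|\delta|\le\frac12\|f\|_\infty^{-1}$ we have $\mathbf 1+\delta f\in\mathcal D_\zeta(\mathcal Z)$ and $$\mathscr R_\zeta(\mathbf 1+\delta f)=\delta^2\bigl(\mathscr E_\zeta(f)+\delta R\bigr),$$ where the remainder $R$ satisfies $|R|\le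 3\|M\|_\infty\,|\mathcal Z|\,\|f\|_\infty^3$.
   Context: $\mathcal Z$ is a finite set with $|\mathcal Z|\ge2$. $M\in\mathbb R^{|\mathcal Z|\times|\mathcal Z|}$ is a fixed irreducible generator (transition rate matrix: off-diagonal entries $\ge0$, rows sum to $0$), not necessarily reversible. $\mathcal P_+(\mathcal Z)$ is the set of strictly positive probability measures on $\mathcal Z$, viewed as vectors in $\mathbb R^{|\mathcal Z|}$. $\mathbf 1$ is the constant function $1$ and $\langle\mathbf 1\rangle$ its span. $\mathbb E_\zeta[f]=\sum_z f(z)\zeta(z)$. $\mathbb R^{|\mathcal Z|}_{>0}$ is the set of vectors with strictly positive coordinates, and $\mathcal D_\zeta(\mathcal Z)=\{\varphi\in\mathbb R^{|\mathcal Z|}_{>0}:\mathbb E_\zeta[\varphi]=1\}$. $\|f\|_\infty=\max_z|f(z)|$ and $\|M\|_\infty=\max_{z,z'}|M(z,z')|$. (For $f=0$ the bound on $\delta$ in item 4 is void.) For $f\in\mathbb R^{|\mathcal Z|}$ the generalised Dirichlet form is $$\mathscr E_\zeta(f)=\tfrac12\sum_{z,z'\in\mathcal Z}M(z,z')\zeta(z)\bigl(f(z)-f(z')\bigr)^2.$$ For $\varphi\in\mathcal D_\zeta(\mathcal Z)$ the generalised Fisher information is $$\mathscr R_\zeta(\varphi)=\sum_{z,z'\in\mathcal Z}M(z,z')\zeta(z)\varphi(z)\Bigl[\tfrac{\varphi(z')}{\varphi(z)}-1-\log\tfrac{\varphi(z')}{\varphi(z)}\Bigr].$$ *)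

theory Defs
  imports "HOL-Analysis.Analysis"
begin

text \<open>The finite state space is the type \<open>'z\<close>. Functions and measures on it are
  vectors in \<open>real ^ 'z\<close>, and \<open>M $ z $ z'\<close> is the rate of jumping from \<open>z\<close> to \<open>z'\<close>.\<close>

definition generator :: "real ^ 'z ^ 'z \<Rightarrow> bool" where
  "generator M \<longleftrightarrow>
     (\<forall>z z'. z \<noteq> z' \<longrightarrow> 0 \<le> M $ z $ z') \<and> (\<forall>z. (\<Sum>z'\<in>UNIV. M $ z $ z') = 0)"

definition irreducible_rates :: "real ^ 'z ^ 'z \<Rightarrow> bool" where
  "irreducible_rates M \<longleftrightarrow> (\<forall>z z'. (z, z') \<in> {(x, y). 0 < M $ x $ y}\<^sup>*)"

definition pos_prob :: "(real ^ 'z) set" where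
  "pos_prob = {\<zeta>. (\<forall>z. 0 < \<zeta> $ z) \<and> (\<Sum>z\<in>UNIV. \<zeta> $ z) = 1}"

definition expect :: "real ^ 'z \<Rightarrow> real ^ 'z \<Rightarrow> real" where
  "expect \<zeta> f = (\<Sum>z\<in>UNIV. f $ z * \<zeta> $ z)"

definition densities :: "real ^ 'z \<Rightarrow> (real ^ 'z) set" where
  "densities \<zeta> = {\<phi>. (\<forall>z. 0 < \<phi> $ z) \<and> expect \<zeta> \<phi> = 1}"

definition dirichlet_form :: "real ^ 'z ^ 'z \<Rightarrow> real ^ 'z \<Rightarrow> real ^ 'z \<Rightarrow> real" where
  "dirichlet_form M \<zeta> f =
     1 / 2 * (\<Sum>z\<in>UNIV. \<Sum>z'\<in>UNIV. M $ z $ z' * \<zeta> $ z * (f $ z - f $ z')\<^sup>2)"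

definition fisher_info :: "real ^ 'z ^ 'z \<Rightarrow> real ^ 'z \<Rightarrow> real ^ 'z \<Rightarrow> real" where
  "fisher_info M \<zeta> \<phi> =
     (\<Sum>z\<in>UNIV. \<Sum>z'\<in>UNIV. M $ z $ z' * \<zeta> $ z * \<phi> $ z *
        (\<phi> $ z' / \<phi> $ z - 1 - ln (\<phi> $ z' / \<phi> $ z)))"

text \<open>On vectors and on matrices, the library's \<open>infnorm\<close> is the largest absolute value of an
  entry; for matrices it is not the operator norm induced by the maximum norm.\<close>

lemma infnorm_vec_eq_Max:
  fixes f :: "real ^ 'z"
  shows "infnorm f = Max (range (\<lambda>z. \<bar>f $ z\<bar>))"
proof -
  have "(\<lambda>i. \<bar>f \<bullet> i\<bar>) ` Basis = range (\<lambda>z. \<bar>f $ z\<bar>)"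
    by (force simp: Basis_vec_def inner_axis)
  then show ?thesis by (simp add: infnorm_Max)
qed

lemma infnorm_matrix_eq_Max:
  fixes M :: "real ^ 'z ^ 'z"
  shows "infnorm M = Max (range (\<lambda>(z, z'). \<bar>M $ z $ z'\<bar>))"
proof -
  have "(\<lambda>i. \<bar>M \<bullet> i\<bar>) ` Basis = range (\<lambda>(z, z'). \<bar>M $ z $ z'\<bar>)"
    by (force simp: Basis_vec_def inner_axis)
  then show ?thesis by (simp add: infnorm_Max)
qed

end

theory Submission
  imports Defs
begin

text \<open>Both functionals are sums over edges of a non-negative rate times a discrepancy between the
  endpoint values that vanishes exactly when these agree. By irreducibility a zero sum therefore
  forces a constant function. The Fisher discrepancy \<open>y - x + x ln (x / y)\<close> is jointly convex, being
  the supremum of its tangent functionals (an instance of \<open>ln r \<le> r - 1\<close>). The connection formula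
  is the Taylor expansion \<open>ln (1 + x) = x - x\<^sup>2 / 2 + O(x\<^sup>3)\<close> on each edge.\<close>

section \<open>Non-negativity and the equality cases\<close>

text \<open>A vanishing sum of non-negative terms vanishes termwise, so \<open>f\<close> agrees
  along every edge of positive rate and hence along directed paths, which join any two
  states.\<close>

lemma edge_sum_nonneg_eq_0_iff:
  fixes M :: "real ^ 'z ^ 'z" and w :: "'z \<Rightarrow> real" and f :: "'z \<Rightarrow> 'a"
  assumes gen: "generator M" and irr: "irreducible_rates M"
    and w: "\<And>z. 0 < w z" and d_nonneg: "\<And>z z'. 0 \<le> d z z'"
    and d_eq_0: "\<And>z z'. d z z' = 0 \<longleftrightarrow> f z = f z'"
  shows "0 \<le> (\<Sum>z\<in>UNIV. \<Sum>z'\<in>UNIV. M $ z $ z' * w z * d z z')" (is "0 \<le> ?S")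
    and "(\<Sum>z\<in>UNIV. \<Sum>z'\<in>UNIV. M $ z $ z' * w z * d z z') = 0 \<longleftrightarrow> (\<forall>x y. f x = f y)"
proof -
  have nonneg: "0 \<le> M $ z $ z' * w z * d z z'" for z z'
  proof (cases "z = z'")
    case True
    \<comment> \<open>The diagonal rate may be negative, but its term vanishes because
      \<open>d z z = 0\<close>.\<close>
    then show ?thesis using d_eq_0[of z z'] by simp
  next
    case False
    then show ?thesis using gen w[of z] d_nonneg[of z z'] by (simp add: generator_def)
  qed
  show "0 \<le> ?S" by (intro sum_nonneg nonneg)
  show "?S = 0 \<longleftrightarrow> (\<forall>x y. f x = f y)"
  proof
    assume "?S = 0"
    then have zero: "M $ z $ z' * w z * d z z' = 0" for z z'
      by (simp add: sum_nonneg_eq_0_iff nonneg sum_nonneg)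
    have edge: "f z = f z'" if "0 < M $ z $ z'" for z z'
      using zero[of z z'] that w[of z] d_eq_0[of z z'] by simp
    show "\<forall>x y. f x = f y"
    proof (intro allI)
      fix x y
      have "(x, y) \<in> {(x, y). 0 < M $ x $ y}\<^sup>*"
        using irr by (simp add: irreducible_rates_def)
      then show "f x = f y"
        by (induction rule: rtrancl_induct) (auto dest: edge)
    qed
  next
    assume "\<forall>x y. f x = f y"
    then show "?S = 0" using d_eq_0 by simp
  qed
qed

lemma mem_span_one_iff:
  fixes f :: "real ^ 'z"
  shows "f \<in> span {1} \<longleftrightarrow> (\<forall>x y. f $ x = f $ y)"
proof
  assume "f \<in> span {1}"
  then show "\<forall>x y. f $ x = f $ y" by (auto simp: span_singleton)
next
  assume "\<forall>x y. f $ x = f $ y"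
  \<comment> \<open>Any coordinate may serve as the scalar; \<open>undefined\<close> merely picks
    one.\<close>
  then have "f = f $ undefined *\<^sub>R 1" by (simp add: vec_eq_iff)
  then show "f \<in> span {1}" by (auto simp: span_singleton)
qed

text \<open>A constant equals its own mean under a probability measure, and the normalisation fixes
  that mean to be 1.\<close>

lemma density_const_iff:
  assumes "\<zeta> \<in> pos_prob" "\<phi> \<in> densities \<zeta>"
  shows "(\<forall>x y. \<phi> $ x = \<phi> $ y) \<longleftrightarrow> \<phi> = 1"
proof
  assume const: "\<forall>x y. \<phi> $ x = \<phi> $ y"
  have "\<phi> $ z = 1" for z
  proof -
    have "1 = (\<Sum>y\<in>UNIV. \<phi> $ y * \<zeta> $ y)"
      using assms by (simp add: densities_def expect_def)
    also have "\<dots> = (\<Sum>y\<in>UNIV. \<phi> $ z * \<zeta> $ y)"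
      using const by (metis (no_types))
    also have "\<dots> = \<phi> $ z"
      using assms by (simp add: pos_prob_def flip: sum_distrib_left)
    finally show ?thesis by simp
  qed
  then show "\<phi> = 1" by (simp add: vec_eq_iff)
qed simp

lemma dirichlet_form_nonneg_eq_0_iff:
  assumes "generator M" "irreducible_rates M" "\<zeta> \<in> pos_prob"
  shows "0 \<le> dirichlet_form M \<zeta> f" and "dirichlet_form M \<zeta> f = 0 \<longleftrightarrow> f \<in> span {1}"
proof -
  have "0 < \<zeta> $ z" for z using assms by (simp add: pos_prob_def)
  note edge_sum = edge_sum_nonneg_eq_0_iff[OF assms(1,2) this,
      where d = "\<lambda>z z'. (f $ z - f $ z')\<^sup>2" and f = "($) f"]
  show "0 \<le> dirichlet_form M \<zeta> f"
    using edge_sum(1) by (simp add: dirichlet_form_def)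
  show "dirichlet_form M \<zeta> f = 0 \<longleftrightarrow> f \<in> span {1}"
    using edge_sum(2) by (simp add: dirichlet_form_def mem_span_one_iff)
qed

lemma fisher_info_nonneg_eq_0_iff:
  assumes "generator M" "irreducible_rates M" "\<zeta> \<in> pos_prob" "\<phi> \<in> densities \<zeta>"
  shows "0 \<le> fisher_info M \<zeta> \<phi>" and "fisher_info M \<zeta> \<phi> = 0 \<longleftrightarrow> \<phi> = 1"
proof -
  let ?d = "\<lambda>z z'. \<phi> $ z * (\<phi> $ z' / \<phi> $ z - 1 - ln (\<phi> $ z' / \<phi> $ z))"
  have \<zeta>: "0 < \<zeta> $ z" for z using assms by (simp add: pos_prob_def)
  have \<phi>: "0 < \<phi> $ z" for z using assms by (simp add: densities_def)
  have ratio: "0 < \<phi> $ z' / \<phi> $ z" for z z' using \<phi> by simp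
  \<comment> \<open>With r the ratio of the two values, r - 1 - ln r is non-negative and vanishes
    only at r = 1.\<close>
  have nonneg: "0 \<le> ?d z z'" for z z'
    using \<phi>[of z] ln_le_minus_one[OF ratio[of z' z]] by simp
  have eq_0: "?d z z' = 0 \<longleftrightarrow> \<phi> $ z = \<phi> $ z'" for z z'
    using \<phi>[of z] ln_eq_minus_one[OF ratio[of z' z]] by auto
  note edge_sum = edge_sum_nonneg_eq_0_iff[OF assms(1,2) \<zeta> nonneg eq_0]
  show "0 \<le> fisher_info M \<zeta> \<phi>"
    using edge_sum(1) by (simp add: fisher_info_def mult.assoc)
  show "fisher_info M \<zeta> \<phi> = 0 \<longleftrightarrow> \<phi> = 1"
    using edge_sum(2) density_const_iff[OF assms(3,4)] by (simp add: fisher_info_def mult.assoc)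
qed

section \<open>Continuity\<close>

lemma continuous_on_dirichlet_form:
  "continuous_on A (\<lambda>(\<eta>, f). dirichlet_form M \<eta> f)"
  unfolding dirichlet_form_def case_prod_beta by (intro continuous_intros)

text \<open>Strict positivity of densities settles the side conditions of quotient and logarithm.
  The domain is a \<open>SIGMA\<close> because the normalisation depends on the measure.\<close>

lemma continuous_on_fisher_info:
  "continuous_on (SIGMA \<eta>:A. densities \<eta>) (\<lambda>(\<eta>, \<phi>). fisher_info M \<eta> \<phi>)"
  unfolding fisher_info_def case_prod_beta
  by (intro continuous_intros) (auto simp: densities_def less_imp_neq[THEN not_sym])

section \<open>Convexity\<close>

lemma convex_on_sum_functions:
  assumes "convex S" and "\<And>i. i \<in> I \<Longrightarrow> convex_on S (f i)"
  shows "convex_on S (\<lambda>x. \<Sum>i\<in>I. f i x)"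
  using assms(2)
proof (induction I rule: infinite_finite_induct)
  case (insert i I)
  then show ?case by (simp add: convex_on_add)
\<comment> \<open>For an empty or infinite \<open>I\<close> the sum is the zero function, and what
  remains of \<open>convex_on\<close> is the convexity of \<open>S\<close>.\<close>
qed (use assms(1) in \<open>auto simp: convex_on_def\<close>)

text \<open>Off the diagonal the terms are non-negative multiples of convex functions. On the
  diagonal, where the rate may be negative, the term is zero throughout \<open>S\<close>.\<close>

lemma convex_on_edge_sum:
  fixes M :: "real ^ 'z ^ 'z" and w :: "'z \<Rightarrow> real"
  assumes gen: "generator M" and w: "\<And>z. 0 \<le> w z" and S: "convex S"
    and conv: "\<And>z z'. z \<noteq> z' \<Longrightarrow> convex_on S (d z z')"
    and diag: "\<And>z x. x \<in> S \<Longrightarrow> d z z x = 0"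
  shows "convex_on S (\<lambda>x. \<Sum>z\<in>UNIV. \<Sum>z'\<in>UNIV. M $ z $ z' * w z * d z z' x)"
proof -
  have "convex_on S (\<lambda>x. M $ z $ z' * w z * d z z' x)" for z z'
  proof (cases "z = z'")
    case True
    then show ?thesis using S diag by (auto simp: convex_on_def convex_def)
  next
    case False
    then show ?thesis
      using gen w by (intro convex_on_cmul conv) (auto simp: generator_def)
  qed
  then show ?thesis by (intro convex_on_sum_functions S)
qed

lemma convex_densities: "convex (densities \<zeta>)"
proof (rule convexI)
  fix x y :: "real ^ 'a" and u v :: real
  assume xy: "x \<in> densities \<zeta>" "y \<in> densities \<zeta>" and uv: "0 \<le> u" "0 \<le> v" "u + v = 1"
  have "0 < u * x $ z + v * y $ z" for z
  proof -
    have "0 < x $ z" "0 < y $ z" using xy by (auto simp: densities_def)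
    \<comment> \<open>Strict positivity must come from a summand of positive weight: if
      \<open>u = 0\<close>, then \<open>v = 1\<close>.\<close>
    then show ?thesis
      using uv by (cases "u = 0") (auto intro: add_pos_nonneg)
  qed
  moreover have "expect \<zeta> (u *\<^sub>R x + v *\<^sub>R y) = u * expect \<zeta> x + v * expect \<zeta> y"
    by (simp add: expect_def algebra_simps sum.distrib sum_distrib_left)
  ultimately show "u *\<^sub>R x + v *\<^sub>R y \<in> densities \<zeta>"
    using xy uv by (simp add: densities_def)
qed

lemma convex_on_dirichlet_form:
  assumes gen: "generator M" and \<zeta>: "\<And>z. 0 \<le> \<zeta> $ z"
  shows "convex_on UNIV (dirichlet_form M \<zeta>)"
proof -
  have sq: "convex_on UNIV (\<lambda>f. (f $ z - f $ z')\<^sup>2)" for z z' :: 'a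
  proof -
    have "(u * a + v * b)\<^sup>2 \<le> u * a\<^sup>2 + v * b\<^sup>2"
      if "0 \<le> u" "0 \<le> v" "u + v = 1" for a b u v :: real
      using convex_onD[OF convex_power2, of v a b] that
      by (simp add: eq_diff_eq[symmetric])
    \<comment> \<open>Taking coordinate differences for \<open>a\<close> and \<open>b\<close>
      composes the square with a linear functional.\<close>
    from this[of _ _ "_ $ z - _ $ z'" "_ $ z - _ $ z'"] show ?thesis
      by (simp add: convex_on_def algebra_simps)
  qed
  have "convex_on UNIV (\<lambda>f. \<Sum>z\<in>UNIV. \<Sum>z'\<in>UNIV. M $ z $ z' * \<zeta> $ z * (f $ z - f $ z')\<^sup>2)"
    by (rule convex_on_edge_sum[OF gen \<zeta> _ sq]) auto
  from convex_on_cmul[OF _ this, of "1 / 2"] show ?thesis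
    by (simp add: dirichlet_form_def[abs_def])
qed

text \<open>The right side is the tangent plane at (p, q) of the concave, positively homogeneous
  function x ln (y / x). The bound is ln r \<le> r - 1 at r = (y / x) / (q / p), multiplied by
  x.\<close>

lemma relative_entropy_tangent_le:
  fixes x y p q :: real
  assumes "0 < x" "0 < y" "0 < p" "0 < q"
  shows "x * ln (y / x) \<le> x * ln (q / p) + y * (p / q) - x"
proof -
  have "ln ((y / x) / (q / p)) \<le> (y / x) / (q / p) - 1"
    using assms by (intro ln_le_minus_one) simp
  then have "ln (y / x) \<le> ln (q / p) + (y / x) / (q / p) - 1"
    using assms by (subst (asm) ln_divide_pos) auto
  from mult_left_mono[OF this, of x] assms show ?thesis
    by (simp add: right_diff_distrib distrib_left)
qed

text \<open>Stated as concavity of x ln (y / x), the negative of the relative entropy term. Both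
  points are compared with the one tangent plane at their mixture (p, q); by linearity the average
  is its value at (p, q), where it touches the function.\<close>

lemma relative_entropy_jointly_convex:
  fixes x1 x2 y1 y2 u v :: real
  assumes pos: "0 < x1" "0 < x2" "0 < y1" "0 < y2" and uv: "0 \<le> u" "0 \<le> v" "u + v = 1"
  shows "u * (x1 * ln (y1 / x1)) + v * (x2 * ln (y2 / x2))
    \<le> (u * x1 + v * x2) * ln ((u * y1 + v * y2) / (u * x1 + v * x2))"
proof -
  define p where "p = u * x1 + v * x2"
  define q where "q = u * y1 + v * y2"
  have pq: "0 < p" "0 < q"
    using pos uv unfolding p_def q_def by (cases "u = 0"; auto intro: add_pos_nonneg)+
  have "u * (x1 * ln (y1 / x1)) + v * (x2 * ln (y2 / x2))
    \<le> u * (x1 * ln (q / p) + y1 * (p / q) - x1) + v * (x2 * ln (q / p) + y2 * (p / q) - x2)"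
    using pos pq uv by (intro add_mono mult_left_mono relative_entropy_tangent_le)
  also have "\<dots> = p * ln (q / p) + q * (p / q) - p"
    unfolding p_def q_def by (simp only: algebra_simps)
  also have "\<dots> = p * ln (q / p)" using pq by simp
  finally show ?thesis by (simp add: p_def q_def)
qed

lemma convex_on_fisher_info:
  assumes gen: "generator M" and \<zeta>: "\<And>z. 0 \<le> \<zeta> $ z"
  shows "convex_on (densities \<zeta>) (fisher_info M \<zeta>)"
proof -
  \<comment> \<open>The factor \<open>\<phi> $ z\<close> belongs to the discrepancy, since the
    weights in \<open>convex_on_edge_sum\<close> do not depend on the argument.\<close>
  let ?d = "\<lambda>z z' \<phi>. \<phi> $ z * (\<phi> $ z' / \<phi> $ z - 1 - ln (\<phi> $ z' / \<phi> $ z))"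
  \<comment> \<open>Multiplying out leaves a linear part minus the jointly concave term.\<close>
  have expand: "?d z z' \<phi> = \<phi> $ z' - \<phi> $ z - \<phi> $ z * ln (\<phi> $ z' / \<phi> $ z)"
    if "\<phi> \<in> densities \<zeta>" for \<phi> z z'
  proof -
    have "0 < \<phi> $ z" using that by (simp add: densities_def)
    then show ?thesis by (simp add: right_diff_distrib)
  qed
  have conv: "convex_on (densities \<zeta>) (?d z z')" for z z'
    unfolding convex_on_def
  proof (intro conjI convex_densities ballI allI impI)
    fix x y u v
    assume xy: "x \<in> densities \<zeta>" "y \<in> densities \<zeta>" and uv: "0 \<le> u" "0 \<le> v" "u + v = (1::real)"
    have mem: "u *\<^sub>R x + v *\<^sub>R y \<in> densities \<zeta>"
      using convexD[OF convex_densities xy uv] .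
    have "u * (x $ z * ln (x $ z' / x $ z)) + v * (y $ z * ln (y $ z' / y $ z))
        \<le> (u * x $ z + v * y $ z) * ln ((u * x $ z' + v * y $ z') / (u * x $ z + v * y $ z))"
      using xy uv by (intro relative_entropy_jointly_convex) (auto simp: densities_def)
    then show "?d z z' (u *\<^sub>R x + v *\<^sub>R y) \<le> u * ?d z z' x + v * ?d z z' y"
      unfolding expand[OF mem] expand[OF xy(1)] expand[OF xy(2)] by (simp add: algebra_simps)
  qed
  have "convex_on (densities \<zeta>) (\<lambda>\<phi>. \<Sum>z\<in>UNIV. \<Sum>z'\<in>UNIV. M $ z $ z' * \<zeta> $ z * ?d z z' \<phi>)"
    by (rule convex_on_edge_sum[OF gen \<zeta> convex_densities conv]) (auto simp: expand)
  then show ?thesis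
    by (simp add: fisher_info_def[abs_def] mult.assoc)
qed

section \<open>Expansion of the Fisher information around the constant density\<close>

text \<open>The error \<open>g\<close> has derivative t^2 / (1 + t), which lies between 0 and 2 t^2
  for t \<ge> -1/2. Hence \<open>g\<close> and \<open>h\<close> = 2/3 t^3 - \<open>g\<close> both
  increase through 0 at the origin, which traps \<open>g x\<close> between 0 and 2/3 x^3 for either
  sign of x.\<close>

lemma abs_ln_one_plus_taylor2:
  fixes x :: real
  assumes "\<bar>x\<bar> \<le> 1 / 2"
  shows "\<bar>ln (1 + x) - x + x\<^sup>2 / 2\<bar> \<le> 2 / 3 * \<bar>x\<bar> ^ 3"
proof -
  define g :: "real \<Rightarrow> real" where "g = (\<lambda>t. ln (1 + t) - t + t\<^sup>2 / 2)"
  define h :: "real \<Rightarrow> real" where "h = (\<lambda>t. 2 / 3 * t ^ 3 - g t)"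
  have g_deriv: "(g has_real_derivative t\<^sup>2 / (1 + t)) (at t)" if "- 1 / 2 \<le> t" for t
    using that unfolding g_def
    by (auto intro!: derivative_eq_intros simp: field_simps power2_eq_square)
  have h_deriv: "(h has_real_derivative 2 * t\<^sup>2 - t\<^sup>2 / (1 + t)) (at t)" if "- 1 / 2 \<le> t" for t
    unfolding h_def by (rule derivative_eq_intros g_deriv that refl | simp)+
  have "t\<^sup>2 / (1 + t) \<le> t\<^sup>2 / (1 / 2)" if "- 1 / 2 \<le> t" for t :: real
    using that by (intro divide_left_mono) auto
  then have h_deriv_nonneg: "0 \<le> 2 * t\<^sup>2 - t\<^sup>2 / (1 + t)" if "- 1 / 2 \<le> t" for t :: real
    using that by force
  have g_mono: "g a \<le> g b" and h_mono: "h a \<le> h b" if "- 1 / 2 \<le> a" "a \<le> b" for a b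
  proof -
    show "g a \<le> g b"
    proof (rule DERIV_nonneg_imp_nondecreasing[OF that(2)])
      fix t assume "a \<le> t" "t \<le> b"
      then show "\<exists>y. (g has_real_derivative y) (at t) \<and> 0 \<le> y"
        using that by (intro exI[of _ "t\<^sup>2 / (1 + t)"] conjI g_deriv) auto
    qed
    show "h a \<le> h b"
    proof (rule DERIV_nonneg_imp_nondecreasing[OF that(2)])
      fix t assume "a \<le> t" "t \<le> b"
      then show "\<exists>y. (h has_real_derivative y) (at t) \<and> 0 \<le> y"
        using that by (intro exI[of _ "2 * t\<^sup>2 - t\<^sup>2 / (1 + t)"] conjI h_deriv h_deriv_nonneg) auto
    qed
  qed
  have zero: "g 0 = 0" "h 0 = 0" by (simp_all add: g_def h_def)
  have "\<bar>g x\<bar> \<le> 2 / 3 * \<bar>x\<bar> ^ 3"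
  proof (cases "0 \<le> x")
    case True
    then show ?thesis using g_mono[of 0 x] h_mono[of 0 x] zero by (simp add: h_def)
  next
    case False
    then show ?thesis using g_mono[of x 0] h_mono[of x 0] zero assms by (simp add: h_def abs_if)
  qed
  then show ?thesis by (simp add: g_def)
qed

text \<open>Here \<open>u\<close> and \<open>v\<close> stand for the perturbations at the two ends
  of an edge. The remainder is at most s^3 / 2 from the quadratic terms plus 3/2 * 4/3 * s^3 = 2 s^3
  from the logarithms, and 5/2 is rounded up to 3.\<close>

lemma fisher_edge_expansion:
  fixes u v s :: real
  assumes u: "\<bar>u\<bar> \<le> s" and v: "\<bar>v\<bar> \<le> s" and s: "s \<le> 1 / 2"
  shows "\<bar>(1 + u) * ((1 + v) / (1 + u) - 1 - ln ((1 + v) / (1 + u))) - (u - v)\<^sup>2 / 2\<bar>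
    \<le> 3 * s ^ 3"
proof -
  define e :: "real \<Rightarrow> real" where "e = (\<lambda>x. ln (1 + x) - x + x\<^sup>2 / 2)"
  have e_bound: "\<bar>e x\<bar> \<le> 2 / 3 * s ^ 3" if "\<bar>x\<bar> \<le> s" for x
  proof -
    have "\<bar>e x\<bar> \<le> 2 / 3 * \<bar>x\<bar> ^ 3"
      using that s unfolding e_def by (intro abs_ln_one_plus_taylor2) simp
    also have "\<dots> \<le> 2 / 3 * s ^ 3"
      using that by (intro mult_left_mono power_mono) auto
    finally show ?thesis .
  qed
  have pos: "0 < 1 + u" "0 < 1 + v" using u v s by auto
  have "(1 + u) * ((1 + v) / (1 + u) - 1 - ln ((1 + v) / (1 + u)))
      = v - u - (1 + u) * (ln (1 + v) - ln (1 + u))"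
    using pos by (simp add: ln_divide_pos right_diff_distrib)
  \<comment> \<open>Inserting the second-order expansion of both logarithms cancels the linear
    terms, and the quadratic ones form the square; the rest is cubic.\<close>
  also have "\<dots> = (u - v)\<^sup>2 / 2 + (u * (v\<^sup>2 - u\<^sup>2) / 2 - (1 + u) * (e v - e u))"
    unfolding e_def by (simp add: field_simps power2_eq_square)
  finally have eq: "(1 + u) * ((1 + v) / (1 + u) - 1 - ln ((1 + v) / (1 + u))) - (u - v)\<^sup>2 / 2
      = u * (v\<^sup>2 - u\<^sup>2) / 2 - (1 + u) * (e v - e u)"
    by simp
  have "\<bar>v\<^sup>2 - u\<^sup>2\<bar> \<le> s\<^sup>2"
  proof -
    have "u\<^sup>2 \<le> s\<^sup>2" "v\<^sup>2 \<le> s\<^sup>2"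
      using u v by (auto simp: abs_le_square_iff[symmetric])
    then show ?thesis
      using zero_le_power2[of u] zero_le_power2[of v] by linarith
  qed
  then have "\<bar>u\<bar> * \<bar>v\<^sup>2 - u\<^sup>2\<bar> \<le> s * s\<^sup>2"
    using u by (intro mult_mono) auto
  then have 1: "\<bar>u * (v\<^sup>2 - u\<^sup>2) / 2\<bar> \<le> s ^ 3 / 2"
    by (simp add: abs_mult power3_eq_cube power2_eq_square)
  have "\<bar>1 + u\<bar> * \<bar>e v - e u\<bar> \<le> 3 / 2 * (4 / 3 * s ^ 3)"
    using u s e_bound[OF u] e_bound[OF v] by (intro mult_mono) linarith+
  then have 2: "\<bar>(1 + u) * (e v - e u)\<bar> \<le> 2 * s ^ 3"
    by (simp add: abs_mult)
  have "0 \<le> s ^ 3" using u by simp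
  then show ?thesis unfolding eq using 1 2 by linarith
qed

lemma abs_component_le_infnorm_vec:
  fixes f :: "real ^ 'z"
  shows "\<bar>f $ z\<bar> \<le> infnorm f"
  by (simp add: infnorm_vec_eq_Max)

lemma abs_entry_le_infnorm_matrix:
  fixes M :: "real ^ 'z ^ 'z"
  shows "\<bar>M $ z $ z'\<bar> \<le> infnorm M"
  unfolding infnorm_matrix_eq_Max by (rule Max_ge) auto

text \<open>The perturbation is at most 1/2 in each coordinate, which keeps positivity, and has mean
  zero, which keeps the normalisation.\<close>

lemma one_plus_scaleR_mem_densities:
  assumes \<zeta>: "\<zeta> \<in> pos_prob" and f: "expect \<zeta> f = 0" and \<delta>: "\<bar>\<delta>\<bar> * infnorm f \<le> 1 / 2"
  shows "1 + \<delta> *\<^sub>R f \<in> densities \<zeta>"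
proof -
  have "0 < 1 + \<delta> * f $ z" for z
  proof -
    have "\<bar>\<delta> * f $ z\<bar> \<le> \<bar>\<delta>\<bar> * infnorm f"
      by (simp add: abs_mult mult_left_mono abs_component_le_infnorm_vec)
    then show ?thesis using \<delta> by linarith
  qed
  moreover have "expect \<zeta> (1 + \<delta> *\<^sub>R f) = (\<Sum>z\<in>UNIV. \<zeta> $ z) + \<delta> * expect \<zeta> f"
    by (simp add: expect_def algebra_simps sum.distrib sum_distrib_left)
  ultimately show ?thesis using \<zeta> f by (simp add: densities_def pos_prob_def)
qed

text \<open>The edge bound is applied with s = |\<delta>| \<open>infnorm f\<close>. Since
  \<open>\<zeta>\<close> has total mass 1, only the sum over target states costs a factor, so
  \<open>CARD('z)\<close> enters once.\<close>

lemma fisher_info_expansion: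
  fixes M :: "real ^ 'z ^ 'z"
  assumes \<zeta>: "\<zeta> \<in> pos_prob" and \<delta>: "\<bar>\<delta>\<bar> * infnorm f \<le> 1 / 2"
  shows "\<bar>fisher_info M \<zeta> (1 + \<delta> *\<^sub>R f) - \<delta>\<^sup>2 * dirichlet_form M \<zeta> f\<bar>
    \<le> 3 * infnorm M * real CARD('z) * infnorm f ^ 3 * \<bar>\<delta>\<bar> ^ 3"
proof -
  define s where "s = \<bar>\<delta>\<bar> * infnorm f"
  \<comment> \<open>The error on one edge, with the factor \<delta>^2 of the Dirichlet form moved
    inside the square.\<close>
  define r where "r = (\<lambda>z z'. (1 + \<delta> * f $ z) *
    ((1 + \<delta> * f $ z') / (1 + \<delta> * f $ z) - 1 - ln ((1 + \<delta> * f $ z') / (1 + \<delta> * f $ z)))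
    - (\<delta> * f $ z - \<delta> * f $ z')\<^sup>2 / 2)"
  have \<zeta>_pos: "0 < \<zeta> $ z" for z using \<zeta> by (simp add: pos_prob_def)
  have f_bound: "\<bar>\<delta> * f $ z\<bar> \<le> s" for z
    by (simp add: s_def abs_mult mult_left_mono abs_component_le_infnorm_vec)
  have r_bound: "\<bar>r z z'\<bar> \<le> 3 * s ^ 3" for z z'
    unfolding r_def using f_bound \<delta> by (intro fisher_edge_expansion) (auto simp: s_def)
  have "fisher_info M \<zeta> (1 + \<delta> *\<^sub>R f) - \<delta>\<^sup>2 * dirichlet_form M \<zeta> f
      = (\<Sum>z\<in>UNIV. \<Sum>z'\<in>UNIV. M $ z $ z' * \<zeta> $ z * r z z')"
    unfolding fisher_info_def dirichlet_form_def r_def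
    by (simp add: sum_distrib_left right_diff_distrib[symmetric] power_mult_distrib mult_ac
          flip: sum_subtractf)
      (simp add: algebra_simps power2_eq_square)
  also have "\<bar>\<dots>\<bar> \<le> (\<Sum>z\<in>UNIV. \<Sum>z'\<in>(UNIV :: 'z set). infnorm M * \<zeta> $ z * (3 * s ^ 3))"
  proof (intro order_trans[OF sum_abs] sum_mono)
    fix z z'
    show "\<bar>M $ z $ z' * \<zeta> $ z * r z z'\<bar> \<le> infnorm M * \<zeta> $ z * (3 * s ^ 3)"
      unfolding abs_mult using \<zeta>_pos[of z]
      by (intro mult_mono r_bound abs_entry_le_infnorm_matrix) (auto simp: infnorm_pos_le)
  qed
  also have "\<dots> = (\<Sum>z\<in>UNIV. \<zeta> $ z) * (3 * infnorm M * real CARD('z) * s ^ 3)"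
    by (simp add: sum_distrib_left sum_distrib_right mult_ac)
  also have "\<dots> = 3 * infnorm M * real CARD('z) * infnorm f ^ 3 * \<bar>\<delta>\<bar> ^ 3"
    using \<zeta> by (simp add: pos_prob_def s_def power_mult_distrib mult_ac)
  finally show ?thesis .
qed

section \<open>Assembly of the four properties\<close>

theorem proposition3p2:
  fixes M :: "real ^ 'z ^ 'z" and \<zeta> :: "real ^ 'z"
  assumes "2 \<le> CARD('z)"
    and "generator M"
    and "irreducible_rates M"
    and "\<zeta> \<in> pos_prob"
  shows
    "(continuous_on (pos_prob \<times> UNIV) (\<lambda>(\<eta>, f). dirichlet_form M \<eta> f)
      \<and> continuous_on (SIGMA \<eta>:pos_prob. densities \<eta>) (\<lambda>(\<eta>, \<phi>). fisher_info M \<eta> \<phi>))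
    \<and> ((\<forall>f. 0 \<le> dirichlet_form M \<zeta> f \<and> (dirichlet_form M \<zeta> f = 0 \<longleftrightarrow> f \<in> span {1}))
      \<and> (\<forall>\<phi>\<in>densities \<zeta>. 0 \<le> fisher_info M \<zeta> \<phi> \<and> (fisher_info M \<zeta> \<phi> = 0 \<longleftrightarrow> \<phi> = 1)))
    \<and> (convex_on UNIV (dirichlet_form M \<zeta>)
      \<and> convex_on (densities \<zeta>) (fisher_info M \<zeta>))
    \<and> (\<forall>f. expect \<zeta> f = 0 \<longrightarrow>
        (\<forall>\<delta>::real. f = 0 \<or> \<bar>\<delta>\<bar> \<le> 1 / 2 * inverse (infnorm f) \<longrightarrow>
          1 + \<delta> *\<^sub>R f \<in> densities \<zeta>
          \<and> (\<exists>R::real. fisher_info M \<zeta> (1 + \<delta> *\<^sub>R f) = \<delta>\<^sup>2 * (dirichlet_form M \<zeta> f + \<delta> * R)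
              \<and> \<bar>R\<bar> \<le> 3 * infnorm M * real CARD('z) * infnorm f ^ 3)))"
proof (intro conjI allI ballI impI)
  have \<zeta>_nonneg: "0 \<le> \<zeta> $ z" for z
    using assms(4) by (simp add: pos_prob_def less_imp_le)
  show "continuous_on (pos_prob \<times> UNIV) (\<lambda>(\<eta>, f). dirichlet_form M \<eta> f)"
    by (rule continuous_on_dirichlet_form)
  show "continuous_on (SIGMA \<eta>:pos_prob. densities \<eta>) (\<lambda>(\<eta>, \<phi>). fisher_info M \<eta> \<phi>)"
    by (rule continuous_on_fisher_info)
  show "0 \<le> dirichlet_form M \<zeta> f" "dirichlet_form M \<zeta> f = 0 \<longleftrightarrow> f \<in> span {1}" for f
    by (rule dirichlet_form_nonneg_eq_0_iff[OF assms(2-4)])+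
  show "0 \<le> fisher_info M \<zeta> \<phi>" "fisher_info M \<zeta> \<phi> = 0 \<longleftrightarrow> \<phi> = 1"
    if "\<phi> \<in> densities \<zeta>" for \<phi>
    by (rule fisher_info_nonneg_eq_0_iff[OF assms(2-4) that])+
  show "convex_on UNIV (dirichlet_form M \<zeta>)"
    using assms(2) \<zeta>_nonneg by (rule convex_on_dirichlet_form)
  show "convex_on (densities \<zeta>) (fisher_info M \<zeta>)"
    using assms(2) \<zeta>_nonneg by (rule convex_on_fisher_info)
next
  fix f and \<delta> :: real
  assume mean: "expect \<zeta> f = 0" and "f = 0 \<or> \<bar>\<delta>\<bar> \<le> 1 / 2 * inverse (infnorm f)"
  \<comment> \<open>The product form treats both disjuncts alike: for \<open>f = 0\<close> it holds
    for every \<delta>, whereas \<open>inverse 0 = 0\<close> would make the second disjunct force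
    \<delta> = 0.\<close>
  then have \<delta>: "\<bar>\<delta>\<bar> * infnorm f \<le> 1 / 2"
    using infnorm_pos_lt[of f] by (cases "f = 0") (auto simp: field_simps infnorm_0)
  show "1 + \<delta> *\<^sub>R f \<in> densities \<zeta>"
    by (rule one_plus_scaleR_mem_densities[OF assms(4) mean \<delta>])
  let ?C = "3 * infnorm M * real CARD('z) * infnorm f ^ 3"
  let ?D = "fisher_info M \<zeta> (1 + \<delta> *\<^sub>R f) - \<delta>\<^sup>2 * dirichlet_form M \<zeta> f"
  have bound: "\<bar>?D\<bar> \<le> ?C * \<bar>\<delta>\<bar> ^ 3"
    by (rule fisher_info_expansion[OF assms(4) \<delta>])
  \<comment> \<open>For \<open>\<delta> = 0\<close> the witness is \<open>?D / 0 = 0\<close>, and \<open>bound\<close> gives \<open>?D = 0\<close>.\<close>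
  have "fisher_info M \<zeta> (1 + \<delta> *\<^sub>R f) = \<delta>\<^sup>2 * (dirichlet_form M \<zeta> f + \<delta> * (?D / \<delta> ^ 3))"
    using bound by (cases "\<delta> = 0") (simp_all add: field_simps power2_eq_square power3_eq_cube)
  moreover have "\<bar>?D / \<delta> ^ 3\<bar> \<le> ?C"
  proof (cases "\<delta> = 0")
    case True
    then show ?thesis by (simp add: infnorm_pos_le)
  next
    case False
    then show ?thesis using bound by (simp add: abs_divide power_abs pos_divide_le_eq)
  qed
  ultimately show "\<exists>R::real. fisher_info M \<zeta> (1 + \<delta> *\<^sub>R f) = \<delta>\<^sup>2 * (dirichlet_form M \<zeta> f + \<delta> * R)
      \<and> \<bar>R\<bar> \<le> ?C"
    by blast
qed

end
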